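(* Let $\delta,\kappa,\lambda>0$ and $\mu\ge 0$ be constants, $h(x)=\kappa x^2+\mu$ and $g(x)=\lambda x^2$. The equation $$\tanh\big(\sqrt{2\delta}\,\beta\big)=\frac{\delta(2\kappa\beta-\delta)}{\kappa\sqrt{2\delta}}$$ has a unique solution $\beta>0$, which is strictly greater than $\frac{\delta}{2\kappa}$. For this $\beta$, let $A=-\dfrac{\kappa}{\delta^2\cosh(\sqrt{2\delta}\,\beta)}<0$ and $$u(x)=\begin{cases}A\cosh(\sqrt{2\delta}\,x)+\dfrac{\kappa}{\delta}x^2+\dfrac{\kappa+\delta\mu}{\delta^2},&|x|\le\beta,\\[4pt] |x|-\beta+u(\beta),&|x|>\beta.\end{cases}$$ The equation $u(\alpha)=\lambda\alpha^2$ has a unique solution $\alpha>0$. Furthermore, $\alpha>\beta$ if and only if one of the following holds: (a) $\delta\lambda-\kappa<0$; (b) $\delta\lambda-\kappa=0$ and $\mu>0$; (c) $\delta\lambda-\kappa>0$ and $\tanh\sqrt{\dfrac{2\delta\mu}{\delta\lambda-\kappa}}<\sqrt{\dfrac{2\delta\mu}{\delta\lambda-\kappa}}-\dfrac{\delta^2}{\kappa\sqrt{2\delta}}$; in which case $\alpha>\frac{1}{2\lambda}$ and the function $u$ is a candidate for the value function (as defined in the context).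
   Context: Candidate for the value function (for the data $b\equiv0$, $\sigma\equiv1$, constant discount rate $\delta$, running payoff $h(x)=\kappa x^2+\mu$, terminal payoff $g(x)=\lambda x^2$). Let $\mathcal{L}u(x)=\frac12u''(x)-\delta u(x)$. A candidate is a continuous $u:\mathbb{R}\to\mathbb{R}_+$ that is $C^1$ with absolutely continuous first derivative inside $\mathbb{R}\setminus\mathcal{B}$, where $\mathcal{B}$ is a finite set, that satisfies $|u'(x)|\le 1$ for all $x\in\mathbb{R}\setminus\mathcal{B}$, and that has properties (i)–(iii) below, where $\mathcal{C}=\mathrm{cl}\big[\mathrm{int}\{x\in\mathbb{R}\setminus\mathcal{B}: |u'(x)|=1\}\big]$, $\mathcal{S}_{\mathcal W}=\{x: u(x)=g(x)\}$, $\mathcal{S}_{\mathcal C}=\mathrm{cl}\{x: u(x)<g(x)\}$, $\mathcal{S}=\mathcal{S}_{\mathcal W}\cup\mathcal{S}_{\mathcal C}$, $\mathcal{W}=\mathbb{R}\setminus(\mathcal{C}\cup\mathcal{S})$: (i) each of $\mathcal{C},\mathcal{S}_{\mathcal W},\mathcal{S}_{\mathcal C}$ is a finite union of intervals (single points allowed), and $\mathcal{B}\subseteq\mathcal{S}_{\mathcal C}\subseteq\mathcal{C}$; (ii) $\mathcal{L}u+h=0$ Lebesgue-a.e. in $\mathcal{W}$; $\mathcal{L}u+h\ge0$ a.e. in $\mathrm{int}(\mathcal{C}\setminus\mathcal{S})$; $\mathcal{L}u+h=\mathcal{L}g+h\le0$ a.e. in $\mathrm{int}\,\mathcal{S}_{\mathcal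 W}$ (no sign condition in $\mathrm{int}\,\mathcal{S}_{\mathcal C}\setminus\mathcal{B}$); (iii) for every $c\in\mathcal{B}$, with $u'_\mp(c)$ the left/right derivatives, either $u'_-(c)=1$ and $u'_+(c)<1$, or $u'_-(c)>-1$ and $u'_+(c)=-1$. *)

theory Defs
  imports "HOL-Analysis.Analysis"
begin

definition abs_continuous_between :: "(real \<Rightarrow> real) \<Rightarrow> real \<Rightarrow> real \<Rightarrow> bool" where
  "abs_continuous_between f a b \<longleftrightarrow>
     (\<forall>\<epsilon>>0. \<exists>\<eta>>0. \<forall>P :: (real \<times> real) set.
        finite P \<longrightarrow>
        (\<forall>(s, t)\<in>P. a \<le> s \<and> s < t \<and> t \<le> b) \<longrightarrow>
        pairwise (\<lambda>p q. disjnt {fst p<..<snd p} {fst q<..<snd q}) P \<longrightarrow>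
        (\<Sum>(s, t)\<in>P. t - s) < \<eta> \<longrightarrow>
        (\<Sum>(s, t)\<in>P. \<bar>f t - f s\<bar>) < \<epsilon>)"

text \<open>On an open set, absolute continuity is understood locally, that is, on every compact
  interval contained in the set.\<close>

definition abs_continuous_in :: "(real \<Rightarrow> real) \<Rightarrow> real set \<Rightarrow> bool" where
  "abs_continuous_in f S \<longleftrightarrow>
     (\<forall>a b. a \<le> b \<longrightarrow> {a..b} \<subseteq> S \<longrightarrow> abs_continuous_between f a b)"

text \<open>The second derivative is only meant almost everywhere: \<^term>\<open>deriv\<close> is unspecified at
  points of non-differentiability, which form a null set when \<^term>\<open>deriv u\<close> is locally
  absolutely continuous off a finite set.\<close>

definition generator :: "real \<Rightarrow> (real \<Rightarrow> real) \<Rightarrow> real \<Rightarrow> real" where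
  "generator \<delta> u x = 1 / 2 * deriv (deriv u) x - \<delta> * u x"

definition control_region :: "real set \<Rightarrow> (real \<Rightarrow> real) \<Rightarrow> real set" where
  "control_region B u = closure (interior {x \<in> - B. \<bar>deriv u x\<bar> = 1})"

definition stop_wait_region :: "(real \<Rightarrow> real) \<Rightarrow> (real \<Rightarrow> real) \<Rightarrow> real set" where
  "stop_wait_region g u = {x. u x = g x}"

definition stop_control_region :: "(real \<Rightarrow> real) \<Rightarrow> (real \<Rightarrow> real) \<Rightarrow> real set" where
  "stop_control_region g u = closure {x. u x < g x}"

definition stop_region :: "(real \<Rightarrow> real) \<Rightarrow> (real \<Rightarrow> real) \<Rightarrow> real set" where
  "stop_region g u = stop_wait_region g u \<union> stop_control_region g u"

definition wait_region :: "real set \<Rightarrow> (real \<Rightarrow> real) \<Rightarrow> (real \<Rightarrow> real) \<Rightarrow> real set" where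
  "wait_region B g u = - (control_region B u \<union> stop_region g u)"

text \<open>\<^const>\<open>is_interval\<close> covers single points, all kinds of unbounded intervals and the empty set.\<close>

definition finite_union_of_intervals :: "real set \<Rightarrow> bool" where
  "finite_union_of_intervals S \<longleftrightarrow>
     (\<exists>\<I>. finite \<I> \<and> (\<forall>I\<in>\<I>. is_interval I) \<and> S = \<Union>\<I>)"

definition candidate_with ::
  "real \<Rightarrow> (real \<Rightarrow> real) \<Rightarrow> (real \<Rightarrow> real) \<Rightarrow> real set \<Rightarrow> (real \<Rightarrow> real) \<Rightarrow> bool" where
  "candidate_with \<delta> h g B u \<longleftrightarrow>
     finite B \<and>
     (\<forall>x. 0 \<le> u x) \<and>
     continuous_on UNIV u \<and>
     u C1_differentiable_on (- B) \<and>
     abs_continuous_in (deriv u) (- B) \<and>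
     (\<forall>x\<in>- B. \<bar>deriv u x\<bar> \<le> 1) \<and>
     finite_union_of_intervals (control_region B u) \<and>
     finite_union_of_intervals (stop_wait_region g u) \<and>
     finite_union_of_intervals (stop_control_region g u) \<and>
     B \<subseteq> stop_control_region g u \<and>
     stop_control_region g u \<subseteq> control_region B u \<and>
     (AE x in lebesgue. x \<in> wait_region B g u \<longrightarrow> generator \<delta> u x + h x = 0) \<and>
     (AE x in lebesgue. x \<in> interior (control_region B u - stop_region g u) \<longrightarrow>
        generator \<delta> u x + h x \<ge> 0) \<and>
     (AE x in lebesgue. x \<in> interior (stop_wait_region g u) \<longrightarrow>
        generator \<delta> u x + h x = generator \<delta> g x + h x \<and> generator \<delta> g x + h x \<le> 0) \<and>
     (\<forall>c\<in>B. \<exists>l r.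
        (u has_real_derivative l) (at_left c) \<and>
        (u has_real_derivative r) (at_right c) \<and>
        (l = 1 \<and> r < 1 \<or> l > -1 \<and> r = -1))"

text \<open>The exceptional set is determined by \<^term>\<open>u\<close>: the last clause above forces every point of
  \<^term>\<open>B\<close> to be a point of non-differentiability, and there are no others.\<close>

definition candidate :: "real \<Rightarrow> (real \<Rightarrow> real) \<Rightarrow> (real \<Rightarrow> real) \<Rightarrow> (real \<Rightarrow> real) \<Rightarrow> bool" where
  "candidate \<delta> h g u \<longleftrightarrow> (\<exists>B. candidate_with \<delta> h g B u)"

definition running_payoff :: "real \<Rightarrow> real \<Rightarrow> real \<Rightarrow> real" where
  "running_payoff \<kappa> \<mu> x = \<kappa> * x\<^sup>2 + \<mu>"

definition terminal_payoff :: "real \<Rightarrow> real \<Rightarrow> real" where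
  "terminal_payoff lam x = lam * x\<^sup>2"

definition beta_equation :: "real \<Rightarrow> real \<Rightarrow> real \<Rightarrow> bool" where
  "beta_equation \<delta> \<kappa> \<beta> \<longleftrightarrow>
     tanh (sqrt (2 * \<delta>) * \<beta>) = \<delta> * (2 * \<kappa> * \<beta> - \<delta>) / (\<kappa> * sqrt (2 * \<delta>))"

definition coeff_A :: "real \<Rightarrow> real \<Rightarrow> real \<Rightarrow> real" where
  "coeff_A \<delta> \<kappa> \<beta> = - (\<kappa> / (\<delta>\<^sup>2 * cosh (sqrt (2 * \<delta>) * \<beta>)))"

definition inner_u :: "real \<Rightarrow> real \<Rightarrow> real \<Rightarrow> real \<Rightarrow> real \<Rightarrow> real" where
  "inner_u \<delta> \<kappa> \<mu> \<beta> x =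
     coeff_A \<delta> \<kappa> \<beta> * cosh (sqrt (2 * \<delta>) * x) + \<kappa> / \<delta> * x\<^sup>2 + (\<kappa> + \<delta> * \<mu>) / \<delta>\<^sup>2"

definition explicit_u :: "real \<Rightarrow> real \<Rightarrow> real \<Rightarrow> real \<Rightarrow> real \<Rightarrow> real" where
  "explicit_u \<delta> \<kappa> \<mu> \<beta> x =
     (if \<bar>x\<bar> \<le> \<beta> then inner_u \<delta> \<kappa> \<mu> \<beta> x else \<bar>x\<bar> - \<beta> + inner_u \<delta> \<kappa> \<mu> \<beta> \<beta>)"

end

theory Submission
  imports Defs
begin

text \<open>
  Put \<open>\<omega> = sqrt (2 * \<delta>)\<close>. In the variable \<open>y = \<omega> * \<beta>\<close> the equation for \<open>\<beta>\<close> reads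
  \<open>y - tanh y = \<delta>\<^sup>2 / (\<kappa> * \<omega>)\<close>. The function \<open>y - tanh y\<close> has derivative \<open>(tanh y)\<^sup>2\<close>,
  so it increases strictly from \<open>0\<close> to infinity on the half-line; this gives \<open>\<beta>\<close>, and the same
  monotonicity compares \<open>\<beta>\<close> with the threshold in condition (c).

  Inside \<open>[-\<beta>, \<beta>]\<close> the function \<open>u\<close> solves the equation of the waiting region. The equation for
  \<open>\<beta>\<close> says that \<open>u' (\<beta>) = 1\<close>, and the choice of \<open>A\<close> says that \<open>u'' (\<beta>) = 0\<close>, so the linear
  pieces fit twice continuously differentiably: \<open>u\<close> is \<open>C\<^sup>1\<close> with Lipschitz derivative, and
  \<open>u'\<close> rises strictly from \<open>-1\<close> to \<open>1\<close> on \<open>[-\<beta>, \<beta>]\<close>. So the exceptional set of the candidate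
  is empty.

  The free boundary \<open>\<alpha>\<close> is controlled by the quantity \<open>x * u' x - 2 * u x\<close>, which is the
  numerator of the derivative of \<open>u x / x\<^sup>2\<close>. It is negative at \<open>0\<close> and decreases, because inside
  \<open>[0, \<beta>]\<close> its derivative is \<open>A * \<omega> * (y * cosh y - sinh y)\<close> with \<open>y = \<omega> * x\<close>, and
  \<open>y * cosh y - sinh y\<close> is positive, again because \<open>tanh y < y\<close>. Therefore \<open>u x / x\<^sup>2\<close> decreases
  strictly and takes the value \<open>lam\<close> exactly once, and \<open>u\<close> lies below \<open>lam * x\<^sup>2\<close> exactly where
  \<open>\<bar>x\<bar> > \<alpha>\<close>. If \<open>\<alpha> > \<beta>\<close>, then \<open>u' \<alpha> = 1\<close> and negativity at \<open>\<alpha>\<close> is the inequality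
  \<open>\<alpha> > 1 / (2 * lam)\<close>.

  Since \<open>u'' (\<beta>) = 0\<close>, the equation in the waiting region gives \<open>\<delta> * u \<beta> = \<kappa> * \<beta>\<^sup>2 + \<mu>\<close>.
  So \<open>\<alpha> > \<beta>\<close>, that is \<open>u \<beta> > lam * \<beta>\<^sup>2\<close>, becomes \<open>(\<delta> * lam - \<kappa>) * \<beta>\<^sup>2 < \<mu>\<close>, from which the
  three cases can be read off. When this holds, the waiting, control and stopping regions are
  \<open>\<bar>x\<bar> < \<beta>\<close>, \<open>\<beta> \<le> \<bar>x\<bar>\<close> and \<open>\<alpha> \<le> \<bar>x\<bar>\<close>; the sign condition between \<open>\<beta>\<close> and \<open>\<alpha>\<close> holds because
  \<open>\<kappa> * x\<^sup>2 + \<mu> - \<delta> * u x\<close> vanishes at \<open>\<beta>\<close> and is increasing beyond \<open>\<beta> > \<delta> / (2 * \<kappa>)\<close>.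
\<close>

section \<open>The function \<open>y - tanh y\<close>\<close>

lemma self_minus_tanh_strict_mono:
  fixes x y :: real
  assumes "0 \<le> x" "x < y"
  shows "x - tanh x < y - tanh y"
proof (rule DERIV_pos_imp_increasing_open[OF \<open>x < y\<close>])
  fix t assume t: "x < t" "t < y"
  have "((\<lambda>t. t - tanh t) has_real_derivative (tanh t)\<^sup>2) (at t)"
    by (auto intro!: derivative_eq_intros)
  moreover have "(tanh t)\<^sup>2 > 0" using assms t by simp
  ultimately show "\<exists>D. ((\<lambda>t. t - tanh t) has_real_derivative D) (at t) \<and> D > 0" by blast
next
  show "continuous_on {x..y} (\<lambda>t. t - tanh t)"
    by (intro continuous_intros) simp_all
qed

lemma self_minus_tanh_less_iff:
  fixes x y :: real
  assumes "0 \<le> x" "0 \<le> y"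
  shows "x - tanh x < y - tanh y \<longleftrightarrow> x < y"
  using self_minus_tanh_strict_mono[of x y] self_minus_tanh_strict_mono[of y x] assms
  by (cases x y rule: linorder_cases) auto

lemma ex1_self_minus_tanh_eq:
  fixes c :: real
  assumes "c > 0"
  shows "\<exists>!y. y > 0 \<and> y - tanh y = c"
proof -
  have "\<exists>y\<ge>0. y \<le> c + 1 \<and> y - tanh y = c"
  proof (rule IVT')
    show "c \<le> c + 1 - tanh (c + 1)"
      using tanh_real_lt_1[of "c + 1"] by simp
    show "continuous_on {0..c + 1} (\<lambda>t. t - tanh t)"
      by (intro continuous_intros) simp_all
  qed (use assms in auto)
  then obtain y where y: "y \<ge> 0" "y - tanh y = c" by blast
  with assms have "y > 0" by (cases "y = 0") auto
  with y show ?thesis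
    using self_minus_tanh_less_iff by (metis less_eq_real_def linorder_cases order_less_irrefl)
qed

lemma sinh_less_self_times_cosh:
  fixes x :: real
  assumes "x > 0"
  shows "sinh x < x * cosh x"
proof -
  have "tanh x < x" using self_minus_tanh_strict_mono[of 0 x] assms by simp
  then show ?thesis by (simp add: tanh_def divide_simps)
qed

section \<open>Gluing, absolute continuity and unions of intervals\<close>

text \<open>The difference quotients of the two branches have the same limit, hence so
  does their mixture along any predicate. This joins the inner and the outer formula for \<open>u\<close>.\<close>
lemma has_real_derivative_If:
  fixes f g :: "real \<Rightarrow> real"
  assumes "(f has_real_derivative D) (at c)" "(g has_real_derivative D) (at c)" "f c = g c"
  shows "((\<lambda>x. if P x then f x else g x) has_real_derivative D) (at c)"
proof -
  have "((\<lambda>x. if P x then (f x - f c) / (x - c) else (g x - g c) / (x - c)) \<longlongrightarrow> D) (at c)"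
    using assms(1,2) unfolding has_field_derivative_iff
    by (intro filterlim_If) (auto intro: tendsto_mono[OF inf_le1])
  then show ?thesis
    unfolding has_field_derivative_iff using assms(3)
    by (elim Lim_transform_eventually) (auto intro!: eventuallyI)
qed

lemma abs_continuous_in_if_lipschitz:
  fixes f :: "real \<Rightarrow> real"
  assumes L: "\<And>x y. \<bar>f x - f y\<bar> \<le> L * \<bar>x - y\<bar>"
  shows "abs_continuous_in f S"
  unfolding abs_continuous_in_def abs_continuous_between_def
proof (intro allI impI)
  fix a b \<epsilon> :: real assume "\<epsilon> > 0"
  define \<eta> where "\<eta> = \<epsilon> / (\<bar>L\<bar> + 1)"
  have "\<eta> > 0" using \<open>\<epsilon> > 0\<close> by (simp add: \<eta>_def)
  moreover have "(\<Sum>(s, t)\<in>P. \<bar>f t - f s\<bar>) < \<epsilon>"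
    if P: "\<forall>(s, t)\<in>P. a \<le> s \<and> s < t \<and> t \<le> b" and less: "(\<Sum>(s, t)\<in>P. t - s) < \<eta>"
    for P :: "(real \<times> real) set"
  proof -
    have "(\<Sum>(s, t)\<in>P. \<bar>f t - f s\<bar>) \<le> (\<Sum>(s, t)\<in>P. (\<bar>L\<bar> + 1) * (t - s))"
    proof (rule sum_mono, clarify)
      fix s t assume "(s, t) \<in> P"
      with P have "s < t" by auto
      have "\<bar>f t - f s\<bar> \<le> L * (t - s)" using L[of t s] \<open>s < t\<close> by simp
      also have "\<dots> \<le> (\<bar>L\<bar> + 1) * (t - s)" using \<open>s < t\<close> by (intro mult_right_mono) auto
      finally show "\<bar>f t - f s\<bar> \<le> (\<bar>L\<bar> + 1) * (t - s)" .
    qed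
    also have "\<dots> = (\<bar>L\<bar> + 1) * (\<Sum>(s, t)\<in>P. t - s)"
      by (simp add: sum_distrib_left case_prod_unfold)
    also have "\<dots> < (\<bar>L\<bar> + 1) * \<eta>" using less by (intro mult_strict_left_mono) auto
    also have "\<dots> = \<epsilon>" by (simp add: \<eta>_def)
    finally show ?thesis .
  qed
  ultimately show "\<exists>\<eta>>0. \<forall>P. finite P \<longrightarrow> (\<forall>(s, t)\<in>P. a \<le> s \<and> s < t \<and> t \<le> b) \<longrightarrow>
      pairwise (\<lambda>p q. disjnt {fst p<..<snd p} {fst q<..<snd q}) P \<longrightarrow>
      (\<Sum>(s, t)\<in>P. t - s) < \<eta> \<longrightarrow> (\<Sum>(s, t)\<in>P. \<bar>f t - f s\<bar>) < \<epsilon>"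
    by blast
qed

lemma finite_union_of_intervals_minus_ball:
  assumes "r > 0"
  shows "finite_union_of_intervals (- ball (0 :: real) r)"
proof -
  have "- ball 0 r = \<Union>{{..- r}, {r..}}" using assms by auto
  moreover have "\<forall>I\<in>{{..- r}, {r..}}. is_interval I" by (simp add: is_interval_ic is_interval_ci)
  ultimately show ?thesis
    unfolding finite_union_of_intervals_def by (metis finite.simps)
qed

lemma finite_union_of_intervals_finite:
  assumes "finite S"
  shows "finite_union_of_intervals S"
  unfolding finite_union_of_intervals_def using assms
  by (intro exI[of _ "(\<lambda>x. {x}) ` S"]) (auto simp: is_interval_def)

section \<open>The equation for \<open>\<beta>\<close>\<close>

text \<open>The right-hand side of the equation is \<open>\<omega> * \<beta> - \<delta>\<^sup>2 / (\<kappa> * \<omega>)\<close> with \<open>\<omega> = sqrt (2 * \<delta>)\<close>,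
  because \<open>\<omega>\<^sup>2 = 2 * \<delta>\<close>.\<close>
lemma beta_equation_iff:
  assumes "\<delta> > 0" "\<kappa> > 0"
  shows "beta_equation \<delta> \<kappa> \<beta> \<longleftrightarrow>
    sqrt (2 * \<delta>) * \<beta> - tanh (sqrt (2 * \<delta>) * \<beta>) = \<delta>\<^sup>2 / (\<kappa> * sqrt (2 * \<delta>))"
proof -
  define w where "w = sqrt (2 * \<delta>)"
  have w: "w > 0" "w * w = 2 * \<delta>" using assms by (auto simp: w_def)
  have "\<delta> * (2 * \<kappa> * \<beta> - \<delta>) = \<kappa> * w * (w * \<beta>) - \<delta>\<^sup>2"
    using w by (simp add: algebra_simps power2_eq_square)
  then have "\<delta> * (2 * \<kappa> * \<beta> - \<delta>) / (\<kappa> * w) = w * \<beta> - \<delta>\<^sup>2 / (\<kappa> * w)"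
    using w assms by (simp add: diff_divide_distrib)
  then show ?thesis unfolding beta_equation_def w_def[symmetric] by auto
qed

lemma ex1_beta:
  assumes "\<delta> > 0" "\<kappa> > 0"
  shows "\<exists>!\<beta>. \<beta> > 0 \<and> beta_equation \<delta> \<kappa> \<beta>"
proof -
  define w where "w = sqrt (2 * \<delta>)"
  have w: "w > 0" using assms by (simp add: w_def)
  have "\<exists>!y. y > 0 \<and> y - tanh y = \<delta>\<^sup>2 / (\<kappa> * w)"
    using assms w by (intro ex1_self_minus_tanh_eq) simp
  then obtain y where y: "y > 0" "y - tanh y = \<delta>\<^sup>2 / (\<kappa> * w)"
    and unique: "\<And>z. z > 0 \<Longrightarrow> z - tanh z = \<delta>\<^sup>2 / (\<kappa> * w) \<Longrightarrow> z = y" by metis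
  show ?thesis
  proof (rule ex1I[of _ "y / w"])
    show "y / w > 0 \<and> beta_equation \<delta> \<kappa> (y / w)"
      using y w assms by (simp add: beta_equation_iff w_def[symmetric])
  next
    fix b assume "b > 0 \<and> beta_equation \<delta> \<kappa> b"
    then have "w * b = y"
      using w assms by (intro unique) (simp_all add: beta_equation_iff w_def[symmetric])
    then show "b = y / w" using w by (simp add: field_simps)
  qed
qed

section \<open>Smooth fit at \<open>\<beta>\<close>\<close>

locale smooth_fit =
  fixes \<delta> \<kappa> \<mu> \<beta> :: real
  assumes delta_pos: "\<delta> > 0" and kappa_pos: "\<kappa> > 0" and mu_nonneg: "\<mu> \<ge> 0"
    and beta_pos: "\<beta> > 0" and beta_eq: "beta_equation \<delta> \<kappa> \<beta>"
begin

definition \<omega> :: real where "\<omega> = sqrt (2 * \<delta>)"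

abbreviation A :: real where "A \<equiv> coeff_A \<delta> \<kappa> \<beta>"
abbreviation v :: "real \<Rightarrow> real" where "v \<equiv> inner_u \<delta> \<kappa> \<mu> \<beta>"
abbreviation u :: "real \<Rightarrow> real" where "u \<equiv> explicit_u \<delta> \<kappa> \<mu> \<beta>"

definition v' :: "real \<Rightarrow> real" where "v' x = A * \<omega> * sinh (\<omega> * x) + 2 * \<kappa> / \<delta> * x"

definition v'' :: "real \<Rightarrow> real" where
  "v'' x = 2 * \<kappa> / \<delta> * (1 - cosh (\<omega> * x) / cosh (\<omega> * \<beta>))"

definition u' :: "real \<Rightarrow> real" where "u' x = (if \<bar>x\<bar> \<le> \<beta> then v' x else sgn x)"

lemma omega_pos: "\<omega> > 0" and omega_sq: "\<omega>\<^sup>2 = 2 * \<delta>"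
  using delta_pos by (auto simp: \<omega>_def)

lemma beta_normalized: "\<omega> * \<beta> - tanh (\<omega> * \<beta>) = \<delta>\<^sup>2 / (\<kappa> * \<omega>)"
  using beta_eq beta_equation_iff[OF delta_pos kappa_pos] by (simp add: \<omega>_def)

lemma beta_gt: "\<beta> > \<delta> / (2 * \<kappa>)"
proof -
  have "tanh (\<omega> * \<beta>) > 0" using omega_pos beta_pos by simp
  then have "0 < \<delta> * (2 * \<kappa> * \<beta> - \<delta>) / (\<kappa> * \<omega>)"
    using beta_eq unfolding beta_equation_def \<omega>_def by metis
  then have "0 < 2 * \<kappa> * \<beta> - \<delta>"
    using delta_pos kappa_pos omega_pos
    by (metis mult_pos_pos zero_less_divide_iff zero_less_mult_pos order_less_asym)
  then show ?thesis using kappa_pos by (simp add: field_simps)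
qed

lemma A_neg: "A < 0"
  using delta_pos kappa_pos by (simp add: coeff_A_def)

lemma A_times_cosh_beta: "A * cosh (\<omega> * \<beta>) = - \<kappa> / \<delta>\<^sup>2"
  using delta_pos cosh_real_pos[of "\<omega> * \<beta>"] by (simp add: coeff_A_def \<omega>_def)

lemma v_has_derivative: "(v has_real_derivative v' x) (at x)"
  unfolding inner_u_def[abs_def] v'_def \<omega>_def[symmetric] using delta_pos
  by (auto intro!: derivative_eq_intros)

lemma v''_alt: "v'' x = 2 * \<delta> * A * cosh (\<omega> * x) + 2 * \<kappa> / \<delta>"
  unfolding v''_def coeff_A_def \<omega>_def[symmetric]
  using delta_pos cosh_real_pos[of "\<omega> * \<beta>"]
  by (simp add: divide_simps power2_eq_square right_diff_distrib)

lemma v'_has_derivative: "(v' has_real_derivative v'' x) (at x)"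
proof -
  have "(v' has_real_derivative A * \<omega> * (cosh (\<omega> * x) * \<omega>) + 2 * \<kappa> / \<delta>) (at x)"
    unfolding v'_def[abs_def] using delta_pos by (auto intro!: derivative_eq_intros)
  then show ?thesis
    unfolding v''_alt omega_sq[symmetric] by (simp add: power2_eq_square mult_ac)
qed

lemma v'_minus: "v' (- x) = - v' x"
  by (simp add: v'_def)

text \<open>The equation for \<open>\<beta>\<close> is exactly the condition that the slope reaches \<open>1\<close> at \<open>\<beta>\<close>.\<close>
lemma v'_beta: "v' \<beta> = 1"
proof -
  have "A * \<omega> * sinh (\<omega> * \<beta>) = A * cosh (\<omega> * \<beta>) * \<omega> * tanh (\<omega> * \<beta>)"
    using cosh_real_pos[of "\<omega> * \<beta>"] by (simp add: tanh_def)
  also have "tanh (\<omega> * \<beta>) = \<omega> * \<beta> - \<delta>\<^sup>2 / (\<kappa> * \<omega>)"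
    using beta_normalized by simp
  also have "A * cosh (\<omega> * \<beta>) * \<omega> * (\<omega> * \<beta> - \<delta>\<^sup>2 / (\<kappa> * \<omega>)) = - \<kappa> / \<delta>\<^sup>2 * \<omega>\<^sup>2 * \<beta> + 1"
    unfolding A_times_cosh_beta using delta_pos kappa_pos omega_pos
    by (simp add: field_simps power2_eq_square)
  finally show ?thesis
    unfolding v'_def omega_sq using delta_pos by (simp add: power2_eq_square)
qed

lemma v''_bounds: "\<bar>x\<bar> \<le> \<beta> \<Longrightarrow> 0 \<le> v'' x" "v'' x \<le> 2 * \<kappa> / \<delta>"
  and v''_pos: "\<bar>x\<bar> < \<beta> \<Longrightarrow> 0 < v'' x"
proof -
  have [simp]: "cosh (\<omega> * \<bar>x\<bar>) = cosh (\<omega> * x)"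
    using omega_pos cosh_real_abs[of "\<omega> * x"] by (simp add: abs_mult)
  have c: "cosh (\<omega> * \<beta>) > 0" "cosh (\<omega> * x) > 0" by simp_all
  show "v'' x \<le> 2 * \<kappa> / \<delta>"
    using c delta_pos kappa_pos unfolding v''_def by (intro mult_left_le) auto
  show "0 \<le> v'' x" if "\<bar>x\<bar> \<le> \<beta>"
    using that c delta_pos kappa_pos omega_pos beta_pos
      cosh_real_nonneg_le_iff[of "\<omega> * \<bar>x\<bar>" "\<omega> * \<beta>"]
    unfolding v''_def by (intro mult_nonneg_nonneg) (simp_all add: divide_simps)
  show "0 < v'' x" if "\<bar>x\<bar> < \<beta>"
    using that c delta_pos kappa_pos omega_pos beta_pos
      cosh_real_nonneg_less_iff[of "\<omega> * \<bar>x\<bar>" "\<omega> * \<beta>"]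
    unfolding v''_def by (intro mult_pos_pos) (simp_all add: divide_simps)
qed

lemma v'_strict_mono: "v' x < v' y" if "- \<beta> \<le> x" "x < y" "y \<le> \<beta>"
proof (rule DERIV_pos_imp_increasing_open[OF \<open>x < y\<close>])
  fix t assume "x < t" "t < y"
  with that have "v'' t > 0" by (intro v''_pos) auto
  then show "\<exists>D. (v' has_real_derivative D) (at t) \<and> D > 0"
    using v'_has_derivative by blast
next
  show "continuous_on {x..y} v'"
    using v'_has_derivative by (intro continuous_at_imp_continuous_on) (blast intro: DERIV_isCont)
qed

lemma v'_lipschitz:
  assumes "\<bar>x\<bar> \<le> \<beta>" "\<bar>y\<bar> \<le> \<beta>"
  shows "\<bar>v' x - v' y\<bar> \<le> 2 * \<kappa> / \<delta> * \<bar>x - y\<bar>"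
proof -
  have "norm (v' x - v' y) \<le> 2 * \<kappa> / \<delta> * norm (x - y)"
  proof (rule field_differentiable_bound[of "{- \<beta>..\<beta>}" v' v''])
    fix z assume "z \<in> {- \<beta>..\<beta>}"
    then show "(v' has_real_derivative v'' z) (at z within {- \<beta>..\<beta>})"
      "norm (v'' z) \<le> 2 * \<kappa> / \<delta>"
      using v'_has_derivative v''_bounds[of z] by (auto intro: has_field_derivative_at_within)
  qed (use assms in auto)
  then show ?thesis by simp
qed

lemma inner_equation: "1 / 2 * v'' x - \<delta> * v x + (\<kappa> * x\<^sup>2 + \<mu>) = 0"
  using delta_pos unfolding v''_alt inner_u_def \<omega>_def[symmetric]
  by (simp add: field_simps power2_eq_square)

text \<open>Here \<open>v'' \<beta> = 0\<close> turns the differential equation into an explicit value.\<close>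
lemma v_beta: "\<delta> * v \<beta> = \<kappa> * \<beta>\<^sup>2 + \<mu>"
  using inner_equation[of \<beta>] by (simp add: v''_def)

section \<open>The function \<open>u\<close> and its derivative\<close>

lemma u_minus: "u (- x) = u x"
  by (simp add: explicit_u_def inner_u_def)

lemma u_has_derivative: "(u has_real_derivative u' x) (at x)"
proof -
  let ?o = "\<lambda>x. \<bar>x\<bar> - \<beta> + v \<beta>"
  have outer: "(?o has_real_derivative sgn x) (at x)" if "x \<noteq> 0"
  proof -
    have linear: "((\<lambda>t. sgn x * t - \<beta> + v \<beta>) has_real_derivative sgn x) (at x)"
      by (auto intro!: derivative_eq_intros)
    have "open (if x > 0 then {0<..} else {..<0} :: real set)" by simp
    then show ?thesis
      by (rule has_field_derivative_transform_within_open[OF linear])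
        (use that in \<open>auto split: if_splits\<close>)
  qed
  consider "\<bar>x\<bar> < \<beta>" | "\<bar>x\<bar> = \<beta>" | "\<bar>x\<bar> > \<beta>" by linarith
  then show ?thesis
  proof cases
    case 1
    have "(u has_real_derivative v' x) (at x)"
      by (rule has_field_derivative_transform_within_open[OF v_has_derivative, of "ball 0 \<beta>"])
        (use 1 in \<open>auto simp: explicit_u_def\<close>)
    then show ?thesis using 1 by (simp add: u'_def)
  next
    case 2
    have "v' x = sgn x" "v x = v \<beta>"
      using 2 beta_pos v'_beta v'_minus[of \<beta>]
      by (cases "x \<ge> 0"; auto simp: abs_if inner_u_def minus_equation_iff[of x])+
    then show ?thesis
      unfolding explicit_u_def[abs_def] using 2 beta_pos v_has_derivative[of x] outer
      by (intro has_real_derivative_If) (auto simp: u'_def)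
  next
    case 3
    have "(u has_real_derivative sgn x) (at x)"
      by (rule has_field_derivative_transform_within_open[OF outer, of "- cball 0 \<beta>"])
        (use 3 beta_pos in \<open>auto simp: explicit_u_def\<close>)
    then show ?thesis using 3 by (simp add: u'_def)
  qed
qed

lemma deriv_u: "deriv u = u'"
  using u_has_derivative by (auto intro: DERIV_imp_deriv)

text \<open>Because \<open>v'\<close> takes the values \<open>1\<close> and \<open>-1\<close> at the ends of \<open>[-\<beta>, \<beta>]\<close>, extending it by the
  sign is the same as composing it with the projection onto \<open>[-\<beta>, \<beta>]\<close>, which is
  \<open>1\<close>-Lipschitz.\<close>
lemma u'_eq_projection: "u' x = v' (max (- \<beta>) (min \<beta> x))"
  using beta_pos v'_beta v'_minus[of \<beta>]
  by (auto simp: u'_def min_def max_def sgn_if)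

lemma u'_lipschitz: "\<bar>u' x - u' y\<bar> \<le> 2 * \<kappa> / \<delta> * \<bar>x - y\<bar>"
proof -
  let ?p = "\<lambda>x. max (- \<beta>) (min \<beta> x)"
  have "\<bar>u' x - u' y\<bar> \<le> 2 * \<kappa> / \<delta> * \<bar>?p x - ?p y\<bar>"
    unfolding u'_eq_projection using beta_pos by (intro v'_lipschitz) auto
  also have "\<dots> \<le> 2 * \<kappa> / \<delta> * \<bar>x - y\<bar>"
    using delta_pos kappa_pos by (intro mult_left_mono) auto
  finally show ?thesis .
qed

lemma abs_u'_less_1: "\<bar>u' x\<bar> < 1" if "\<bar>x\<bar> < \<beta>"
proof -
  have "u' x = v' x" using that by (simp add: u'_def)
  then show ?thesis
    using that v'_strict_mono[of x \<beta>] v'_strict_mono[of "- \<beta>" x] v'_beta v'_minus[of \<beta>]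
    by (simp add: abs_less_iff)
qed

lemma abs_u'_eq_1: "\<bar>x\<bar> \<ge> \<beta> \<Longrightarrow> \<bar>u' x\<bar> = 1"
  using beta_pos v'_beta v'_minus[of \<beta>]
  by (cases "x \<ge> 0") (simp_all add: u'_eq_projection min.absorb1 min.absorb2 max.absorb1)

lemma u_0_pos: "u 0 > 0"
proof -
  have "cosh (\<omega> * \<beta>) > 1"
    using omega_pos beta_pos cosh_real_nonneg_less_iff[of 0 "\<omega> * \<beta>"] by simp
  then have "\<kappa> / \<delta>\<^sup>2 / cosh (\<omega> * \<beta>) < \<kappa> / \<delta>\<^sup>2"
    using delta_pos kappa_pos by (simp add: divide_simps)
  moreover have "u 0 = \<kappa> / \<delta>\<^sup>2 - \<kappa> / \<delta>\<^sup>2 / cosh (\<omega> * \<beta>) + \<mu> / \<delta>"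
    using beta_pos delta_pos
    by (simp add: explicit_u_def inner_u_def coeff_A_def \<omega>_def[symmetric] add_divide_distrib
        power2_eq_square)
  moreover have "\<mu> / \<delta> \<ge> 0" using mu_nonneg delta_pos by simp
  ultimately show ?thesis by simp
qed

lemma u'_nonneg: "x \<ge> 0 \<Longrightarrow> u' x \<ge> 0"
  using v'_strict_mono[of 0 x] beta_pos
  by (cases "x = 0") (auto simp: u'_def v'_def)

lemma u_pos: "u x > 0"
proof -
  have "u 0 \<le> u \<bar>x\<bar>"
  proof (rule DERIV_nonneg_imp_nondecreasing[where f = u])
    fix t :: real assume "0 \<le> t"
    then show "\<exists>D. (u has_real_derivative D) (at t) \<and> D \<ge> 0"
      using u_has_derivative[of t] u'_nonneg[of t] by blast
  qed simp
  moreover have "u \<bar>x\<bar> = u x" using u_minus[of x] by (simp add: abs_if)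
  ultimately show ?thesis using u_0_pos by simp
qed

section \<open>Comparison with \<open>lam * x\<^sup>2\<close>\<close>

text \<open>The difference of the two sides is the derivative of \<open>u x / x\<^sup>2\<close> times \<open>x\<^sup>3\<close>. It starts at
  \<open>- 2 * u 0\<close>, decreases on \<open>[0, \<beta>]\<close> because of \<open>sinh y < y * cosh y\<close> and \<open>A < 0\<close>, and is
  \<open>- x\<close> plus a constant beyond \<open>\<beta>\<close>.\<close>
lemma self_times_u'_less:
  assumes "x \<ge> 0"
  shows "x * u' x < 2 * u x"
proof -
  let ?k = "\<lambda>x. x * v' x - 2 * v x"
  have inner: "?k x < 0" if x: "0 \<le> x" "x \<le> \<beta>" for x
  proof -
    have "?k x \<le> ?k 0"
    proof (rule DERIV_nonpos_imp_nonincreasing[OF \<open>0 \<le> x\<close>])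
      fix t assume t: "0 \<le> t" "t \<le> x"
      have "(?k has_real_derivative t * v'' t - v' t) (at t)"
        by (auto intro!: derivative_eq_intros v_has_derivative v'_has_derivative)
      moreover have "t * v'' t - v' t = A * \<omega> * (\<omega> * t * cosh (\<omega> * t) - sinh (\<omega> * t))"
        unfolding v''_alt v'_def omega_sq[symmetric] using delta_pos
        by (simp add: algebra_simps power2_eq_square)
      moreover have "A * \<omega> * (\<omega> * t * cosh (\<omega> * t) - sinh (\<omega> * t)) \<le> 0"
        using A_neg omega_pos t sinh_less_self_times_cosh[of "\<omega> * t"]
        by (cases "t = 0") (auto intro!: mult_nonpos_nonneg)
      ultimately show "\<exists>D. (?k has_real_derivative D) (at t) \<and> D \<le> 0" by metis
    qed
    also have "?k 0 < 0" using u_0_pos beta_pos by (simp add: explicit_u_def)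
    finally show ?thesis .
  qed
  show ?thesis
  proof (cases "x \<le> \<beta>")
    case True
    then show ?thesis using inner[of x] assms by (simp add: u'_def explicit_u_def)
  next
    case False
    then show ?thesis using inner[of \<beta>] beta_pos v'_beta
      by (simp add: u'_def explicit_u_def)
  qed
qed

lemma u_over_square_strict_decreasing:
  assumes "0 < x" "x < y"
  shows "u y / y\<^sup>2 < u x / x\<^sup>2"
proof (rule DERIV_neg_imp_decreasing[OF \<open>x < y\<close>])
  fix t assume "x \<le> t" "t \<le> y"
  with assms have t: "t > 0" by simp
  have "((\<lambda>x. u x / x\<^sup>2) has_real_derivative (u' t * t\<^sup>2 - u t * (2 * t)) / (t\<^sup>2 * t\<^sup>2)) (at t)"
    using t by (auto intro!: derivative_eq_intros u_has_derivative)
  moreover have "u' t * t\<^sup>2 - u t * (2 * t) = t * (t * u' t - 2 * u t)"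
    by (simp add: algebra_simps power2_eq_square)
  moreover have "t * (t * u' t - 2 * u t) < 0"
    using t self_times_u'_less[of t] by (simp add: mult_pos_neg)
  ultimately show "\<exists>D. ((\<lambda>x. u x / x\<^sup>2) has_real_derivative D) (at t) \<and> D < 0"
    using t by (metis divide_neg_pos zero_less_mult_iff zero_less_power)
qed

lemma ex_alpha:
  assumes "lam > 0"
  shows "\<exists>\<alpha>>0. u \<alpha> = lam * \<alpha>\<^sup>2"
proof -
  \<comment> \<open>Large enough for \<open>lam * M \<ge> 1 + lam * v \<beta>\<close> and \<open>lam * M \<ge> 1\<close>, whence \<open>lam * M\<^sup>2 \<ge> M + v \<beta>\<close>.\<close>
  define M where "M = \<beta> + 1 / lam + v \<beta>"
  have "v \<beta> > 0" using u_pos[of \<beta>] beta_pos by (simp add: explicit_u_def)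
  then have M: "M > \<beta>" using assms by (simp add: M_def add_pos_pos)
  have lM: "lam * M = lam * \<beta> + 1 + lam * v \<beta>"
    using assms by (simp add: M_def algebra_simps)
  have "M + v \<beta> \<le> M * (1 + lam * v \<beta>)"
  proof -
    have "1 * v \<beta> \<le> (lam * M) * v \<beta>"
      using lM \<open>v \<beta> > 0\<close> assms beta_pos by (intro mult_right_mono) auto
    then show ?thesis by (simp add: algebra_simps)
  qed
  also have "\<dots> \<le> M * (lam * M)"
    using lM assms beta_pos M by (intro mult_left_mono) auto
  finally have "u M - lam * M\<^sup>2 \<le> 0"
    using M beta_pos by (simp add: explicit_u_def power2_eq_square algebra_simps)
  moreover have "u 0 - lam * 0\<^sup>2 \<ge> 0" using u_0_pos by simp
  moreover have "isCont (\<lambda>x. u x - lam * x\<^sup>2) x" for x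
    using u_has_derivative[THEN DERIV_isCont] by (intro continuous_intros) auto
  ultimately obtain x where "0 \<le> x" "u x - lam * x\<^sup>2 = 0"
    using IVT2[of "\<lambda>x. u x - lam * x\<^sup>2" M 0 0] M beta_pos by auto
  then show ?thesis using u_0_pos by (intro exI[of _ x]) (cases "x = 0"; simp)
qed

end

section \<open>The free boundary \<open>\<alpha>\<close>\<close>

locale free_boundary = smooth_fit +
  fixes lam \<alpha> :: real
  assumes lam_pos: "lam > 0" and alpha_pos: "\<alpha> > 0" and u_alpha: "u \<alpha> = lam * \<alpha>\<^sup>2"
begin

lemma u_over_square_alpha: "u \<alpha> / \<alpha>\<^sup>2 = lam"
  using u_alpha alpha_pos by simp

lemma u_compare:
  assumes "x > 0"
  shows "u x < lam * x\<^sup>2 \<longleftrightarrow> \<alpha> < x" "u x = lam * x\<^sup>2 \<longleftrightarrow> x = \<alpha>"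
proof -
  have "u x < lam * x\<^sup>2 \<longleftrightarrow> u x / x\<^sup>2 < lam" "u x = lam * x\<^sup>2 \<longleftrightarrow> u x / x\<^sup>2 = lam"
    using assms by (auto simp: field_simps)
  then show "u x < lam * x\<^sup>2 \<longleftrightarrow> \<alpha> < x" "u x = lam * x\<^sup>2 \<longleftrightarrow> x = \<alpha>"
    using u_over_square_strict_decreasing[of x \<alpha>] u_over_square_strict_decreasing[of \<alpha> x]
      u_over_square_alpha assms alpha_pos
    by (cases x \<alpha> rule: linorder_cases; auto)+
qed

lemma u_compare_abs: "u x < lam * x\<^sup>2 \<longleftrightarrow> \<alpha> < \<bar>x\<bar>" "u x = lam * x\<^sup>2 \<longleftrightarrow> \<bar>x\<bar> = \<alpha>"
proof -
  have "u \<bar>x\<bar> = u x" using u_minus[of x] by (simp add: abs_if)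
  then show "u x < lam * x\<^sup>2 \<longleftrightarrow> \<alpha> < \<bar>x\<bar>" "u x = lam * x\<^sup>2 \<longleftrightarrow> \<bar>x\<bar> = \<alpha>"
    using u_compare[of "\<bar>x\<bar>"] u_0_pos alpha_pos by (cases "x = 0"; auto)+
qed

lemma beta_less_alpha_iff: "\<beta> < \<alpha> \<longleftrightarrow> (\<delta> * lam - \<kappa>) * \<beta>\<^sup>2 < \<mu>"
proof -
  have "\<beta> < \<alpha> \<longleftrightarrow> lam * \<beta>\<^sup>2 < u \<beta>"
    using u_compare[of \<beta>] beta_pos by linarith
  also have "\<dots> \<longleftrightarrow> \<delta> * (lam * \<beta>\<^sup>2) < \<delta> * u \<beta>"
    using delta_pos by simp
  also have "\<delta> * u \<beta> = \<kappa> * \<beta>\<^sup>2 + \<mu>"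
    using v_beta beta_pos by (simp add: explicit_u_def)
  finally show ?thesis by (simp add: algebra_simps)
qed

text \<open>When \<open>\<delta> * lam > \<kappa>\<close>, the inequality \<open>(\<delta> * lam - \<kappa>) * \<beta>\<^sup>2 < \<mu>\<close> compares \<open>\<omega> * \<beta>\<close> with the
  argument of the hyperbolic tangent in the third case; applying the increasing function
  \<open>y - tanh y\<close> to both sides eliminates \<open>\<beta>\<close>.\<close>
lemma beta_less_alpha_cases:
  "\<beta> < \<alpha> \<longleftrightarrow>
    \<delta> * lam - \<kappa> < 0 \<or>
    \<delta> * lam - \<kappa> = 0 \<and> \<mu> > 0 \<or>
    \<delta> * lam - \<kappa> > 0 \<and>
      tanh (sqrt (2 * \<delta> * \<mu> / (\<delta> * lam - \<kappa>)))
        < sqrt (2 * \<delta> * \<mu> / (\<delta> * lam - \<kappa>)) - \<delta>\<^sup>2 / (\<kappa> * sqrt (2 * \<delta>))"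
proof (cases "\<delta> * lam - \<kappa>" "0 :: real" rule: linorder_cases)
  case less
  then have "(\<delta> * lam - \<kappa>) * \<beta>\<^sup>2 < 0" using beta_pos by (simp add: mult_neg_pos)
  then show ?thesis using less mu_nonneg by (simp add: beta_less_alpha_iff)
next
  case equal
  then show ?thesis by (simp add: beta_less_alpha_iff)
next
  case greater
  let ?d = "\<delta> * lam - \<kappa>"
  let ?z = "sqrt (2 * \<delta> * \<mu> / ?d)"
  have "?z \<ge> 0" using greater delta_pos mu_nonneg by simp
  have "\<beta> < \<alpha> \<longleftrightarrow> \<beta>\<^sup>2 < \<mu> / ?d"
    using greater by (simp add: beta_less_alpha_iff field_simps)
  also have "\<dots> \<longleftrightarrow> 2 * \<delta> * \<beta>\<^sup>2 < 2 * \<delta> * (\<mu> / ?d)"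
    using delta_pos by (intro mult_less_cancel_left_pos[symmetric]) simp
  also have "\<dots> \<longleftrightarrow> (\<omega> * \<beta>)\<^sup>2 < 2 * \<delta> * \<mu> / ?d"
    by (simp add: power_mult_distrib omega_sq)
  also have "\<dots> \<longleftrightarrow> \<omega> * \<beta> < ?z"
    using omega_pos beta_pos
    by (simp add: real_sqrt_less_iff[of "(\<omega> * \<beta>)\<^sup>2", symmetric] abs_mult)
  also have "\<dots> \<longleftrightarrow> \<omega> * \<beta> - tanh (\<omega> * \<beta>) < ?z - tanh ?z"
    using \<open>?z \<ge> 0\<close> omega_pos beta_pos by (subst self_minus_tanh_less_iff) auto
  also have "\<dots> \<longleftrightarrow> tanh ?z < ?z - \<delta>\<^sup>2 / (\<kappa> * \<omega>)"
    unfolding beta_normalized by auto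
  finally show ?thesis using greater by (simp add: \<omega>_def)
qed

lemma alpha_gt:
  assumes "\<beta> < \<alpha>"
  shows "\<alpha> > 1 / (2 * lam)"
proof -
  have "u' \<alpha> = 1" using assms beta_pos by (simp add: u'_def)
  then have "\<alpha> * 1 < \<alpha> * (2 * lam * \<alpha>)"
    using self_times_u'_less[of \<alpha>] alpha_pos u_alpha by (simp add: power2_eq_square mult_ac)
  then have "1 < 2 * lam * \<alpha>" using alpha_pos mult_less_cancel_left_pos by blast
  then show ?thesis using lam_pos by (simp add: field_simps)
qed

section \<open>The candidate property\<close>

lemma control_region_eq: "control_region {} u = - ball 0 \<beta>"
proof -
  have "{x \<in> - {}. \<bar>deriv u x\<bar> = 1} = - ball 0 \<beta>"
    unfolding deriv_u using abs_u'_less_1 abs_u'_eq_1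
    by (auto simp: not_less) (metis less_irrefl not_less)
  then show ?thesis
    using beta_pos by (simp add: control_region_def interior_complement closure_complement)
qed

lemma stop_wait_region_eq: "stop_wait_region (terminal_payoff lam) u = {- \<alpha>, \<alpha>}"
  using alpha_pos by (auto simp: stop_wait_region_def terminal_payoff_def u_compare_abs)

lemma stop_control_region_eq: "stop_control_region (terminal_payoff lam) u = - ball 0 \<alpha>"
proof -
  have "{x. u x < terminal_payoff lam x} = - cball 0 \<alpha>"
    by (auto simp: terminal_payoff_def u_compare_abs)
  then show ?thesis by (simp add: stop_control_region_def closure_complement)
qed

lemma stop_region_eq: "stop_region (terminal_payoff lam) u = - ball 0 \<alpha>"
  using alpha_pos by (auto simp: stop_region_def stop_wait_region_eq stop_control_region_eq)

lemma generator_inner: "\<bar>x\<bar> < \<beta> \<Longrightarrow> generator \<delta> u x + running_payoff \<kappa> \<mu> x = 0"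
proof -
  assume x: "\<bar>x\<bar> < \<beta>"
  have "(u' has_real_derivative v'' x) (at x)"
    by (rule has_field_derivative_transform_within_open[OF v'_has_derivative, of "ball 0 \<beta>"])
      (use x in \<open>auto simp: u'_def\<close>)
  then have "deriv u' x = v'' x" by (rule DERIV_imp_deriv)
  then show ?thesis
    using inner_equation[of x] x
    by (simp add: generator_def running_payoff_def deriv_u explicit_u_def)
qed

text \<open>Beyond \<open>\<beta>\<close> the second derivative vanishes, and by the value of \<open>u\<close> at \<open>\<beta>\<close> the remaining
  quadratic in \<open>\<bar>x\<bar>\<close> has the root \<open>\<beta>\<close>. The cofactor is positive since \<open>\<beta> > \<delta> / (2 * \<kappa>)\<close>.\<close>
lemma generator_outer: "\<beta> < \<bar>x\<bar> \<Longrightarrow> generator \<delta> u x + running_payoff \<kappa> \<mu> x \<ge> 0"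
proof -
  assume x: "\<beta> < \<bar>x\<bar>"
  let ?S = "{t. sgn t = sgn x} - cball 0 \<beta>"
  have "{t. sgn t = sgn x} = (if x > 0 then {0<..} else {..<0})"
    using x beta_pos by (auto simp: sgn_if)
  then have "open ?S" by (simp add: open_Diff)
  then have "(u' has_real_derivative 0) (at x)"
    by (rule has_field_derivative_transform_within_open[OF DERIV_const[of "sgn x"]])
      (use x in \<open>auto simp: u'_def\<close>)
  then have "deriv u' x = 0" by (rule DERIV_imp_deriv)
  then have "generator \<delta> u x + running_payoff \<kappa> \<mu> x
      = \<kappa> * \<bar>x\<bar>\<^sup>2 + \<mu> - \<delta> * (\<bar>x\<bar> - \<beta> + v \<beta>)"
    using x by (simp add: generator_def running_payoff_def deriv_u explicit_u_def)
  also have "\<dots> = (\<bar>x\<bar> - \<beta>) * (\<kappa> * (\<bar>x\<bar> + \<beta>) - \<delta>)"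
    using v_beta by (simp add: algebra_simps power2_eq_square)
  also have "\<dots> \<ge> 0"
  proof -
    have "\<delta> < \<kappa> * (2 * \<beta>)" using beta_gt kappa_pos by (simp add: field_simps)
    also have "\<dots> \<le> \<kappa> * (\<bar>x\<bar> + \<beta>)" using x kappa_pos by (intro mult_left_mono) auto
    finally show ?thesis using x by simp
  qed
  finally show ?thesis .
qed

text \<open>The almost-everywhere conditions hold at every point of their regions: these avoid
  \<open>\<beta>\<close> and \<open>-\<beta>\<close>, where the formula for \<open>u\<close> changes. The region where \<open>u\<close> touches
  \<open>lam * x\<^sup>2\<close> consists of two points and has empty interior.\<close>
lemma candidate_u:
  assumes "\<beta> < \<alpha>"
  shows "candidate \<delta> (running_payoff \<kappa> \<mu>) (terminal_payoff lam) u"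
proof -
  have u': "(u has_real_derivative u' x) (at x within S)" for x S
    using u_has_derivative by (rule has_field_derivative_at_within)
  have cont: "continuous_on UNIV u" using u' by (auto intro: DERIV_continuous_on)
  have "continuous_on UNIV u'"
  proof -
    have "lipschitz_on (2 * \<kappa> / \<delta>) UNIV u'"
      using u'_lipschitz delta_pos kappa_pos by (intro lipschitz_onI) (auto simp: dist_real_def)
    then show ?thesis by (rule lipschitz_on_continuous_on)
  qed
  then have C1: "u C1_differentiable_on - {}"
    using u' unfolding C1_differentiable_on_def has_real_derivative_iff_has_vector_derivative
    by auto
  have slope: "\<bar>u' x\<bar> \<le> 1" for x
    using abs_u'_less_1[of x] abs_u'_eq_1[of x] by linarith
  have wait: "wait_region {} (terminal_payoff lam) u = ball 0 \<beta>"
    using assms by (auto simp: wait_region_def control_region_eq stop_region_eq)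
  have "- ball 0 \<beta> - - ball 0 \<alpha> = ball 0 \<alpha> \<inter> - ball (0 :: real) \<beta>" by blast
  then have "interior (control_region {} u - stop_region (terminal_payoff lam) u)
      = ball 0 \<alpha> - cball 0 \<beta>"
    using beta_pos
    by (simp add: control_region_eq stop_region_eq interior_Int interior_complement Diff_eq)
  then have "AE x in lebesgue.
      x \<in> interior (control_region {} u - stop_region (terminal_payoff lam) u) \<longrightarrow>
      generator \<delta> u x + running_payoff \<kappa> \<mu> x \<ge> 0"
    using generator_outer by auto
  moreover have "interior (stop_wait_region (terminal_payoff lam) u) = {}"
    by (simp add: stop_wait_region_eq empty_interior_finite)
  moreover have "finite_union_of_intervals (stop_wait_region (terminal_payoff lam) u)"
    by (simp add: stop_wait_region_eq finite_union_of_intervals_finite)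
  ultimately have "candidate_with \<delta> (running_payoff \<kappa> \<mu>) (terminal_payoff lam) {} u"
    unfolding candidate_with_def
    using cont C1 slope generator_inner u_pos[THEN less_imp_le] assms
      abs_continuous_in_if_lipschitz[OF u'_lipschitz]
    by (auto simp: deriv_u wait control_region_eq stop_control_region_eq
        finite_union_of_intervals_minus_ball[OF beta_pos]
        finite_union_of_intervals_minus_ball[OF alpha_pos])
  then show ?thesis unfolding candidate_def by blast
qed

end

theorem proposition2:
  fixes \<delta> \<kappa> lam \<mu> :: real
  assumes "\<delta> > 0" and "\<kappa> > 0" and "lam > 0" and "\<mu> \<ge> 0"
  shows "(\<exists>!\<beta>. \<beta> > 0 \<and> beta_equation \<delta> \<kappa> \<beta>) \<and>
    (\<forall>\<beta>. \<beta> > 0 \<and> beta_equation \<delta> \<kappa> \<beta> \<longrightarrow>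
       \<beta> > \<delta> / (2 * \<kappa>) \<and>
       coeff_A \<delta> \<kappa> \<beta> < 0 \<and>
       (\<exists>!\<alpha>. \<alpha> > 0 \<and> explicit_u \<delta> \<kappa> \<mu> \<beta> \<alpha> = lam * \<alpha>\<^sup>2) \<and>
       (\<forall>\<alpha>. \<alpha> > 0 \<and> explicit_u \<delta> \<kappa> \<mu> \<beta> \<alpha> = lam * \<alpha>\<^sup>2 \<longrightarrow>
          (\<alpha> > \<beta> \<longleftrightarrow>
             \<delta> * lam - \<kappa> < 0 \<or>
             \<delta> * lam - \<kappa> = 0 \<and> \<mu> > 0 \<or>
             \<delta> * lam - \<kappa> > 0 \<and>
               tanh (sqrt (2 * \<delta> * \<mu> / (\<delta> * lam - \<kappa>)))
                 < sqrt (2 * \<delta> * \<mu> / (\<delta> * lam - \<kappa>)) - \<delta>\<^sup>2 / (\<kappa> * sqrt (2 * \<delta>))) \<and>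
          (\<alpha> > \<beta> \<longrightarrow>
             \<alpha> > 1 / (2 * lam) \<and>
             candidate \<delta> (running_payoff \<kappa> \<mu>) (terminal_payoff lam) (explicit_u \<delta> \<kappa> \<mu> \<beta>))))"
proof (rule conjI[OF ex1_beta[OF assms(1,2)]], intro allI impI, elim conjE)
  fix \<beta> assume "\<beta> > 0" "beta_equation \<delta> \<kappa> \<beta>"
  then interpret smooth_fit \<delta> \<kappa> \<mu> \<beta>
    using assms by unfold_locales
  have boundary: "free_boundary \<delta> \<kappa> \<mu> \<beta> lam \<alpha>" if "\<alpha> > 0" "u \<alpha> = lam * \<alpha>\<^sup>2" for \<alpha>
    using that assms by unfold_locales
  have "\<exists>!\<alpha>. \<alpha> > 0 \<and> u \<alpha> = lam * \<alpha>\<^sup>2"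
    using ex_alpha[OF \<open>lam > 0\<close>] boundary free_boundary.u_compare(2) by metis
  moreover have "(\<alpha> > \<beta> \<longleftrightarrow>
             \<delta> * lam - \<kappa> < 0 \<or>
             \<delta> * lam - \<kappa> = 0 \<and> \<mu> > 0 \<or>
             \<delta> * lam - \<kappa> > 0 \<and>
               tanh (sqrt (2 * \<delta> * \<mu> / (\<delta> * lam - \<kappa>)))
                 < sqrt (2 * \<delta> * \<mu> / (\<delta> * lam - \<kappa>)) - \<delta>\<^sup>2 / (\<kappa> * sqrt (2 * \<delta>))) \<and>
          (\<alpha> > \<beta> \<longrightarrow>
             \<alpha> > 1 / (2 * lam) \<and>
             candidate \<delta> (running_payoff \<kappa> \<mu>) (terminal_payoff lam) u)"
    if "\<alpha> > 0 \<and> u \<alpha> = lam * \<alpha>\<^sup>2" for \<alpha>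
  proof -
    interpret free_boundary \<delta> \<kappa> \<mu> \<beta> lam \<alpha> using that boundary by blast
    show ?thesis using beta_less_alpha_cases alpha_gt candidate_u by blast
  qed
  ultimately show "\<beta> > \<delta> / (2 * \<kappa>) \<and>
       A < 0 \<and>
       (\<exists>!\<alpha>. \<alpha> > 0 \<and> u \<alpha> = lam * \<alpha>\<^sup>2) \<and>
       (\<forall>\<alpha>. \<alpha> > 0 \<and> u \<alpha> = lam * \<alpha>\<^sup>2 \<longrightarrow>
          (\<alpha> > \<beta> \<longleftrightarrow>
             \<delta> * lam - \<kappa> < 0 \<or>
             \<delta> * lam - \<kappa> = 0 \<and> \<mu> > 0 \<or>
             \<delta> * lam - \<kappa> > 0 \<and>
               tanh (sqrt (2 * \<delta> * \<mu> / (\<delta> * lam - \<kappa>)))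
                 < sqrt (2 * \<delta> * \<mu> / (\<delta> * lam - \<kappa>)) - \<delta>\<^sup>2 / (\<kappa> * sqrt (2 * \<delta>))) \<and>
          (\<alpha> > \<beta> \<longrightarrow>
             \<alpha> > 1 / (2 * lam) \<and>
             candidate \<delta> (running_payoff \<kappa> \<mu>) (terminal_payoff lam) u))"
    using beta_gt A_neg by blast
qed

end
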